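(* Consider implicit-deadline multi-frame tasks scheduled on one processor by preemptive rate-monotonic (RM) scheduling. Let $\tau_k$ be a multi-frame task with $k-1$ higher-priority multi-frame tasks $\tau_1,\dots,\tau_{k-1}$, which are assumed to be schedulable. For $i=1,\dots,k-1$ let $\ell_i=\lfloor T_k/T_i\rfloor$ and $$f_i=\frac{\phi_i(1)\cdot\ell_i}{\delta_i^{\min}(\ell_i+1)},$$ and let $f=\min_{1\le i\le k-1}f_i$. Then $\tau_k$ is schedulable under RM if $$\left(\frac{U_k}{f}+1\right)\prod_{j=1}^{k-1}\left(\frac{U_j}{f}+1\right)\le\frac{f+1}{f}$$ or $$\sum_{j=1}^{k}U_j\le f\,k\left(\left(\frac{f+1}{f}\right)^{\frac1k}-1\right).$$ Moreover, $f_i\ge\dfrac{\phi_i(1)}{\phi_i(2)-\phi_i(1)}$ for each $i=1,\dots,k-1$.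
   Context: A multi-frame task $\tau_i$ with $m_i\ge2$ frames is a sporadic task with period (minimum inter-arrival time) $T_i$ and an array $C_{i,0},\dots,C_{i,m_i-1}$ of positive execution times; the execution time of its $j$-th job is $C_{i,(j \bmod m_i)}$. Implicit deadlines: a job released at $r$ has absolute deadline $r+T_i$. The (peak) utilization is $U_i=\max_j C_{i,j}/T_i$. $\phi_i(\ell)$ denotes the maximum of the sum of the execution times of any $\ell$ (cyclically) consecutive frames of $\tau_i$, with $\phi_i(0)=0$; in particular $U_i=\phi_i(1)/T_i$. $\delta_i(j)=\phi_i(j)-\phi_i(j-1)$ for $j\ge1$, and $\delta_i^{\min}(\ell)=\min_{1\le j\le\ell}\delta_i(j)$. RM: tasks with smaller periods have higher priority (so $T_i\le T_k$ for $i<k$); at any time the ready job of highest priority is executed. A task is schedulable if all its jobs always finish by their absolute deadlines. $k\ge2$. *)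

theory Defs
  imports "HOL-Analysis.Analysis" "HOL-Library.Extended_Nat"
begin

record mf_task =
  period :: real
  frames :: "real list"

definition valid_mf_task :: "mf_task \<Rightarrow> bool" where
  "valid_mf_task v \<longleftrightarrow>
     0 < period v \<and> 2 \<le> length (frames v) \<and> (\<forall>c \<in> set (frames v). 0 < c)"

definition exec_time :: "mf_task \<Rightarrow> nat \<Rightarrow> real" where
  "exec_time v j = frames v ! (j mod length (frames v))"

definition utilization :: "mf_task \<Rightarrow> real" where
  "utilization v = Max ((\<lambda>c. c / period v) ` set (frames v))"

definition phi :: "mf_task \<Rightarrow> nat \<Rightarrow> real" where
  "phi v l = Max ((\<lambda>h. \<Sum>q<l. exec_time v (h + q)) ` {..<length (frames v)})"

text \<open>Only used for positive arguments, where the subtraction does not truncate.\<close>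
definition delta :: "mf_task \<Rightarrow> nat \<Rightarrow> real" where
  "delta v j = phi v j - phi v (j - 1)"

definition delta_min :: "mf_task \<Rightarrow> nat \<Rightarrow> real" where
  "delta_min v l = Min (delta v ` {1..l})"

text \<open>
  A task set consists of the tasks with indices 1 to n. A smaller index means higher
  priority. Nondecreasing periods make this the rate-monotonic order, ties between
  equal periods being broken by the index.
\<close>
definition rm_task_set :: "nat \<Rightarrow> (nat \<Rightarrow> mf_task) \<Rightarrow> bool" where
  "rm_task_set n \<tau> \<longleftrightarrow>
     (\<forall>i \<in> {1..n}. valid_mf_task (\<tau> i)) \<and>
     (\<forall>i \<in> {1..n}. \<forall>i' \<in> {1..n}. i < i' \<longrightarrow> period (\<tau> i) \<le> period (\<tau> i'))"

text \<open>
  Task i releases N i jobs (possibly none, possibly infinitely many), the j-th of them,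
  counted from 0, at time r i j. The job is identified by the pair (i, j).
\<close>
definition is_job :: "nat \<Rightarrow> (nat \<Rightarrow> enat) \<Rightarrow> nat \<times> nat \<Rightarrow> bool" where
  "is_job n N J \<longleftrightarrow> fst J \<in> {1..n} \<and> enat (snd J) < N (fst J)"

definition legal_releases ::
  "nat \<Rightarrow> (nat \<Rightarrow> mf_task) \<Rightarrow> (nat \<Rightarrow> enat) \<Rightarrow> (nat \<Rightarrow> nat \<Rightarrow> real) \<Rightarrow> bool" where
  "legal_releases n \<tau> N r \<longleftrightarrow>
     (\<forall>i j. is_job n N (i, j) \<longrightarrow> 0 \<le> r i j) \<and>
     (\<forall>i j. is_job n N (i, Suc j) \<longrightarrow> r i j + period (\<tau> i) \<le> r i (Suc j))"

text \<open>
  A schedule maps each time to the job executing then, or to None if the processor idles.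
  The service of a job up to t is the total time it executes in the interval from 0 to t.
\<close>
definition service :: "(real \<Rightarrow> (nat \<times> nat) option) \<Rightarrow> nat \<times> nat \<Rightarrow> real \<Rightarrow> real" where
  "service \<sigma> J t = measure lebesgue {s. 0 \<le> s \<and> s < t \<and> \<sigma> s = Some J}"

definition finished_by ::
  "(nat \<Rightarrow> mf_task) \<Rightarrow> (real \<Rightarrow> (nat \<times> nat) option) \<Rightarrow> nat \<times> nat \<Rightarrow> real \<Rightarrow> bool" where
  "finished_by \<tau> \<sigma> J t \<longleftrightarrow> exec_time (\<tau> (fst J)) (snd J) \<le> service \<sigma> J t"

definition ready ::
  "nat \<Rightarrow> (nat \<Rightarrow> mf_task) \<Rightarrow> (nat \<Rightarrow> enat) \<Rightarrow> (nat \<Rightarrow> nat \<Rightarrow> real) \<Rightarrow>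
   (real \<Rightarrow> (nat \<times> nat) option) \<Rightarrow> nat \<times> nat \<Rightarrow> real \<Rightarrow> bool" where
  "ready n \<tau> N r \<sigma> J t \<longleftrightarrow>
     is_job n N J \<and> r (fst J) (snd J) \<le> t \<and> \<not> finished_by \<tau> \<sigma> J t"

text \<open>Jobs of the same task are served in order of release.\<close>
definition higher_priority :: "nat \<times> nat \<Rightarrow> nat \<times> nat \<Rightarrow> bool" where
  "higher_priority J J' \<longleftrightarrow> fst J < fst J' \<or> fst J = fst J' \<and> snd J < snd J'"

text \<open>
  Since priorities well-order the jobs, the equivalence says that the ready job of
  highest priority executes whenever some job is ready, and that the processor idles
  otherwise.
\<close>
definition rm_schedule ::
  "nat \<Rightarrow> (nat \<Rightarrow> mf_task) \<Rightarrow> (nat \<Rightarrow> enat) \<Rightarrow> (nat \<Rightarrow> nat \<Rightarrow> real) \<Rightarrow>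
   (real \<Rightarrow> (nat \<times> nat) option) \<Rightarrow> bool" where
  "rm_schedule n \<tau> N r \<sigma> \<longleftrightarrow>
     (\<forall>J. {s. 0 \<le> s \<and> \<sigma> s = Some J} \<in> sets lebesgue) \<and>
     (\<forall>s J. 0 \<le> s \<longrightarrow>
        (\<sigma> s = Some J \<longleftrightarrow>
           ready n \<tau> N r \<sigma> J s \<and>
           (\<forall>J'. ready n \<tau> N r \<sigma> J' s \<longrightarrow> J' \<noteq> J \<longrightarrow> higher_priority J J')))"

definition rm_schedulable :: "nat \<Rightarrow> (nat \<Rightarrow> mf_task) \<Rightarrow> nat \<Rightarrow> bool" where
  "rm_schedulable n \<tau> i \<longleftrightarrow>
     (\<forall>N r \<sigma>. legal_releases n \<tau> N r \<longrightarrow> rm_schedule n \<tau> N r \<sigma> \<longrightarrow>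
        (\<forall>j. is_job n N (i, j) \<longrightarrow> finished_by \<tau> \<sigma> (i, j) (r i j + period (\<tau> i))))"

definition ell :: "(nat \<Rightarrow> mf_task) \<Rightarrow> nat \<Rightarrow> nat \<Rightarrow> nat" where
  "ell \<tau> k i = nat \<lfloor>period (\<tau> k) / period (\<tau> i)\<rfloor>"

definition f_task :: "(nat \<Rightarrow> mf_task) \<Rightarrow> nat \<Rightarrow> nat \<Rightarrow> real" where
  "f_task \<tau> k i =
     phi (\<tau> i) 1 * real (ell \<tau> k i) / delta_min (\<tau> i) (ell \<tau> k i + 1)"

definition f_min :: "(nat \<Rightarrow> mf_task) \<Rightarrow> nat \<Rightarrow> real" where
  "f_min \<tau> k = Min (f_task \<tau> k ` {1..k - 1})"

end

theory Submission
  imports Defs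
begin

text \<open>
  If a job of \<open>\<tau>\<^sub>k\<close> misses its deadline, then the processor is busy from the start of the
  surrounding busy period up to that deadline, so for every \<open>x\<close> in \<open>(0, T\<^sub>k]\<close> the demand
  \<open>\<phi>\<^sub>k(1) + (\<Sum>i<k. \<phi>\<^sub>i(\<lceil>x / T\<^sub>i\<rceil>))\<close> exceeds \<open>x\<close>. Put \<open>t\<^sub>i = \<ell>\<^sub>i T\<^sub>i\<close>. For \<open>x \<le> T\<^sub>k\<close>, task \<open>i\<close>
  contributes at most \<open>\<phi>\<^sub>i(\<ell>\<^sub>i) \<le> U\<^sub>i t\<^sub>i\<close> if \<open>x \<le> t\<^sub>i\<close>. Otherwise it contributes at most
  \<open>\<phi>\<^sub>i(\<ell>\<^sub>i + 1)\<close>, a sum of \<open>\<ell>\<^sub>i + 1\<close> increments \<open>\<delta>\<^sub>i(j) \<le> \<phi>\<^sub>i(1)\<close>, of which the smallest is at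
  most \<open>\<ell>\<^sub>i \<phi>\<^sub>i(1) / f\<close>, hence at most \<open>(1 + 1/f) U\<^sub>i t\<^sub>i\<close>.
  Taking \<open>x = t\<^sub>i\<close> in increasing order bounds the total demand by a product of the factors
  \<open>1 + U\<^sub>i/f\<close>; under the product condition this contradicts the demand exceeding \<open>T\<^sub>k\<close> at
  \<open>x = T\<^sub>k\<close>. The sum condition implies the product condition by the AM-GM inequality.
\<close>

section \<open>Workload of a multi-frame task\<close>

lemma exec_time_pos:
  assumes "valid_mf_task v"
  shows "0 < exec_time v j"
proof -
  have "exec_time v j \<in> set (frames v)"
    unfolding exec_time_def using assms
    by (intro nth_mem mod_less_divisor) (auto simp: valid_mf_task_def)
  then show ?thesis using assms by (simp add: valid_mf_task_def)
qed

text \<open>Execution times repeat with the number of frames, so a window with arbitrary start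
  \<open>h\<close> has the same sum as the window starting at \<open>h\<close> reduced modulo that
  number, one of those over which \<open>phi\<close> takes its maximum.\<close>

lemma sum_exec_time_le_phi:
  assumes "valid_mf_task v"
  shows "(\<Sum>q<l. exec_time v (h + q)) \<le> phi v l"
proof -
  have len: "0 < length (frames v)"
    using assms by (auto simp: valid_mf_task_def)
  have "(\<Sum>q<l. exec_time v (h + q)) = (\<Sum>q<l. exec_time v (h mod length (frames v) + q))"
    by (simp add: exec_time_def mod_add_left_eq)
  then show ?thesis
    unfolding phi_def using len by (auto intro!: Max_ge image_eqI[where x = "h mod length (frames v)"])
qed

lemma phi_attained:
  assumes "valid_mf_task v"
  obtains h where "phi v l = (\<Sum>q<l. exec_time v (h + q))"
proof -
  have "{..<length (frames v)} \<noteq> {}"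
    using assms by (auto simp: valid_mf_task_def lessThan_empty_iff)
  then have "phi v l \<in> (\<lambda>h. \<Sum>q<l. exec_time v (h + q)) ` {..<length (frames v)}"
    unfolding phi_def by (intro Max_in) auto
  then show ?thesis using that by auto
qed

lemma phi_0 [simp]: "valid_mf_task v \<Longrightarrow> phi v 0 = 0"
  by (rule phi_attained[of v 0]) auto

lemma exec_time_le_phi_1: "valid_mf_task v \<Longrightarrow> exec_time v j \<le> phi v 1"
  using sum_exec_time_le_phi[of v j 1] by simp

text \<open>A maximizing window extended by one more frame, which is positive, is a candidate for
  the longer length.\<close>

lemma phi_less_Suc:
  assumes "valid_mf_task v"
  shows "phi v l < phi v (Suc l)"
proof -
  obtain h where "phi v l = (\<Sum>q<l. exec_time v (h + q))"
    using phi_attained[OF assms] .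
  with sum_exec_time_le_phi[OF assms, of h "Suc l"] exec_time_pos[OF assms, of "h + l"]
  show ?thesis by simp
qed

lemma phi_mono: "valid_mf_task v \<Longrightarrow> l \<le> l' \<Longrightarrow> phi v l \<le> phi v l'"
  by (rule lift_Suc_mono_le[of "phi v"]) (auto intro: less_imp_le phi_less_Suc)

lemma phi_1_pos: "valid_mf_task v \<Longrightarrow> 0 < phi v 1"
  using phi_less_Suc[of v 0] by simp

text \<open>Dropping the last frame of a maximizing window loses at most \<open>phi v 1\<close> and
  leaves a window of length \<open>l\<close>.\<close>

lemma phi_Suc_le:
  assumes "valid_mf_task v"
  shows "phi v (Suc l) \<le> phi v l + phi v 1"
proof -
  obtain h where "phi v (Suc l) = (\<Sum>q<Suc l. exec_time v (h + q))"
    using phi_attained[OF assms] .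
  with sum_exec_time_le_phi[OF assms, of h l] exec_time_le_phi_1[OF assms, of "h + l"]
  show ?thesis by simp
qed

section \<open>Increments of the workload function\<close>

lemma delta_le_phi_1: "valid_mf_task v \<Longrightarrow> 1 \<le> j \<Longrightarrow> delta v j \<le> phi v 1"
  using phi_Suc_le[of v "j - 1"] by (simp add: delta_def)

lemma delta_pos: "valid_mf_task v \<Longrightarrow> 1 \<le> j \<Longrightarrow> 0 < delta v j"
  using phi_less_Suc[of v "j - 1"] by (simp add: delta_def)

lemma phi_eq_sum_delta: "valid_mf_task v \<Longrightarrow> phi v l = (\<Sum>j = 1..l. delta v j)"
  by (induction l) (auto simp: delta_def)

lemma delta_min_attained:
  assumes "1 \<le> l"
  obtains j where "j \<in> {1..l}" "delta_min v l = delta v j"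
proof -
  have "delta_min v l \<in> delta v ` {1..l}"
    unfolding delta_min_def using assms by (intro Min_in) auto
  then show ?thesis using that by auto
qed

lemma delta_min_le: "j \<in> {1..l} \<Longrightarrow> delta_min v l \<le> delta v j"
  unfolding delta_min_def by (rule Min_le) auto

lemma delta_min_pos: "valid_mf_task v \<Longrightarrow> 1 \<le> l \<Longrightarrow> 0 < delta_min v l"
  by (metis delta_min_attained delta_pos atLeastAtMost_iff)

lemma phi_le_linear: "valid_mf_task v \<Longrightarrow> phi v l \<le> real l * phi v 1"
proof (induction l)
  case (Suc l)
  then show ?case using phi_Suc_le[of v l] by (simp add: algebra_simps)
qed simp

text \<open>A minimal increment is split off from the telescoping sum of \<open>l + 1\<close>
  increments; each of the other \<open>l\<close> is at most \<open>phi v 1\<close>.\<close>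

lemma phi_Suc_le_delta_min:
  assumes "valid_mf_task v"
  shows "phi v (l + 1) \<le> real l * phi v 1 + delta_min v (l + 1)"
proof -
  obtain j where j: "j \<in> {1..l + 1}" "delta_min v (l + 1) = delta v j"
    using delta_min_attained[of "l + 1"] by auto
  have "phi v (l + 1) = delta v j + (\<Sum>i \<in> {1..l + 1} - {j}. delta v i)"
    unfolding phi_eq_sum_delta[OF assms] using j(1) by (intro sum.remove) auto
  also have "(\<Sum>i \<in> {1..l + 1} - {j}. delta v i) \<le> real (card ({1..l + 1} - {j})) * phi v 1"
    by (rule sum_bounded_above, rule delta_le_phi_1[OF assms]) auto
  also have "card ({1..l + 1} - {j}) = l" using j(1) by simp
  finally show ?thesis using j(2) by simp
qed

text \<open>The number \<open>phi v 1\<close> is itself a frame, so its quotient by the period is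
  among those whose maximum is \<open>utilization v\<close>.\<close>

lemma phi_1_le_utilization:
  assumes "valid_mf_task v"
  shows "phi v 1 \<le> utilization v * period v"
proof -
  obtain h where h: "phi v 1 = (\<Sum>q<1. exec_time v (h + q))"
    using phi_attained[OF assms] .
  then have "phi v 1 = frames v ! (h mod length (frames v))"
    by (simp add: exec_time_def)
  moreover have "\<dots> \<in> set (frames v)"
    using assms by (intro nth_mem mod_less_divisor) (auto simp: valid_mf_task_def)
  ultimately have "phi v 1 \<in> set (frames v)" by simp
  then have "phi v 1 / period v \<le> utilization v"
    unfolding utilization_def by (intro Max_ge) auto
  then show ?thesis
    using assms by (simp add: valid_mf_task_def field_simps)
qed

lemma utilization_pos: "valid_mf_task v \<Longrightarrow> 0 < utilization v"
  using phi_1_le_utilization[of v] phi_1_pos[of v]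
  by (smt (verit) valid_mf_task_def mult_nonpos_nonneg)

section \<open>Utilization-based feasibility\<close>

text \<open>Induction along increasing \<open>t\<close>: for the last point \<open>x\<close>, the
  hypothesis bounds \<open>t x\<close> by the left-hand side formed without \<open>x\<close>, so
  inserting \<open>x\<close> multiplies that quantity by at most \<open>b * u x + 1\<close>.\<close>

lemma sum_weighted_le_prod:
  fixes t u :: "'a \<Rightarrow> real"
  assumes "finite A" "0 \<le> b"
    and "\<And>i. i \<in> A \<Longrightarrow> 0 \<le> u i"
    and "\<And>i. i \<in> A \<Longrightarrow> 0 \<le> t i"
    and "\<And>i. i \<in> A \<Longrightarrow> t i \<le> S + b * (\<Sum>j \<in> {j \<in> A. t j < t i}. t j * u j)"
  shows "S + b * (\<Sum>i\<in>A. t i * u i) \<le> S * (\<Prod>i\<in>A. b * u i + 1)"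
  using assms(1,3-)
proof (induction A rule: finite_ranking_induct[where f = t])
  case (insert x A)
  \<comment> \<open>The induction rule provides that \<open>t x\<close> is maximal but leaves
    \<open>x \<in> A\<close> possible; in that case the insertion changes nothing.\<close>
  show ?case
  proof (cases "x \<in> A")
    case False
    have IH: "S + b * (\<Sum>i\<in>A. t i * u i) \<le> S * (\<Prod>i\<in>A. b * u i + 1)" (is "?W \<le> ?P")
    proof (rule insert.IH)
      fix i assume i: "i \<in> A"
      \<comment> \<open>Since \<open>t i \<le> t x\<close>, the new point is never among those
        strictly below \<open>t i\<close>, so the hypothesis passes to \<open>A\<close>.\<close>
      have "{j \<in> insert x A. t j < t i} = {j \<in> A. t j < t i}"
        using insert.hyps(2)[OF i] by auto
      with insert.prems(3)[of i] i
      show "t i \<le> S + b * (\<Sum>j \<in> {j \<in> A. t j < t i}. t j * u j)" by simp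
    qed (use insert.prems in auto)
    have "t x \<le> S + b * (\<Sum>j \<in> {j \<in> insert x A. t j < t x}. t j * u j)"
      using insert.prems(3) by simp
    also have "(\<Sum>j \<in> {j \<in> insert x A. t j < t x}. t j * u j) \<le> (\<Sum>j \<in> A. t j * u j)"
      using insert.prems(1,2) insert.hyps(1) by (intro sum_mono2) auto
    finally have tx: "t x \<le> ?W" using \<open>0 \<le> b\<close> by (simp add: mult_left_mono)
    have "S + b * (\<Sum>i\<in>insert x A. t i * u i) = ?W + (b * u x) * t x"
      using False insert.hyps(1) by (simp add: algebra_simps)
    also have "\<dots> \<le> ?W + (b * u x) * ?W"
      using tx \<open>0 \<le> b\<close> insert.prems(1) by (intro add_left_mono mult_left_mono) auto
    also have "\<dots> = (b * u x + 1) * ?W" by (simp add: algebra_simps)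
    also have "\<dots> \<le> (b * u x + 1) * ?P"
      using IH \<open>0 \<le> b\<close> insert.prems(1) by (intro mult_left_mono) auto
    also have "\<dots> = S * (\<Prod>i\<in>insert x A. b * u i + 1)"
      using False insert.hyps(1) by (simp add: algebra_simps)
    finally show ?thesis .
  qed (use insert in \<open>simp add: insert_absorb\<close>)
qed simp

text \<open>If the demand exceeded \<open>x\<close> throughout the range, the values
  \<open>x = t i\<close> would bound the total demand by a product, which the product condition
  keeps at most \<open>T\<close>; this contradicts the excess at \<open>x = T\<close>.\<close>

lemma exists_feasible_point:
  fixes t u :: "'a \<Rightarrow> real"
  assumes "finite A" "0 < b" "0 < T" "0 < c"
    and u: "\<And>i. i \<in> A \<Longrightarrow> 0 \<le> u i"
    and t: "\<And>i. i \<in> A \<Longrightarrow> 0 < t i" "\<And>i. i \<in> A \<Longrightarrow> t i \<le> T"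
    and prod_le: "(b * c + 1) * (\<Prod>i\<in>A. b * u i + 1) \<le> 1 + b"
  shows "\<exists>x. 0 < x \<and> x \<le> T \<and>
    c * T + (\<Sum>i\<in>A. t i * u i) + b * (\<Sum>i \<in> {i \<in> A. t i < x}. t i * u i) \<le> x"
proof (rule ccontr)
  define S where "S = c * T + (\<Sum>i\<in>A. t i * u i)"
  define P where "P = (\<Prod>i\<in>A. b * u i + 1)"
  assume "\<not> ?thesis"
  then have fail: "x < S + b * (\<Sum>i \<in> {i \<in> A. t i < x}. t i * u i)" if "0 < x" "x \<le> T" for x
    using that unfolding S_def by fastforce
  \<comment> \<open>The failure at \<open>x = t i\<close> is the hypothesis that
    \<open>sum_weighted_le_prod\<close> requires for \<open>i\<close>.\<close>
  have "S + b * (\<Sum>i\<in>A. t i * u i) \<le> S * P"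
    unfolding P_def using assms(1,2) u t
    by (intro sum_weighted_le_prod) (auto intro!: less_imp_le[OF fail] less_imp_le[OF t(1)])
  moreover have "T < S + b * (\<Sum>i\<in>A. t i * u i)"
  proof -
    have "(\<Sum>i \<in> {i \<in> A. t i < T}. t i * u i) \<le> (\<Sum>i\<in>A. t i * u i)"
      using assms(1) u t by (intro sum_mono2) (auto simp: less_imp_le)
    then show ?thesis
      using fail[of T] \<open>0 < T\<close> \<open>0 < b\<close> by (smt (verit) mult_left_mono)
  qed
  \<comment> \<open>The sum of the \<open>t i * u i\<close> equals \<open>S - c * T\<close>.
    Inserting this in the bound by \<open>S * P\<close>, and comparing with \<open>prod_le\<close>
    multiplied by \<open>S\<close>, leaves a common factor \<open>b * c\<close> to cancel.\<close>
  moreover have "S * P \<le> T"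
  proof -
    have "S * (1 + b) \<le> S * P + b * c * T"
      using calculation(1) by (simp add: S_def algebra_simps)
    moreover have "S * ((b * c + 1) * P) \<le> S * (1 + b)"
      using prod_le \<open>0 < T\<close> \<open>0 < c\<close> u t unfolding P_def S_def
      by (intro mult_left_mono add_nonneg_nonneg sum_nonneg) (auto simp: less_imp_le)
    ultimately have "(b * c) * (S * P) \<le> (b * c) * T" by (simp add: algebra_simps)
    then show ?thesis using \<open>0 < b\<close> \<open>0 < c\<close> by simp
  qed
  ultimately show False by linarith
qed

section \<open>Busy periods of a rate-monotonic schedule\<close>

locale rm_run =
  fixes n :: nat and \<tau> :: "nat \<Rightarrow> mf_task" and N :: "nat \<Rightarrow> enat"
    and r :: "nat \<Rightarrow> nat \<Rightarrow> real" and \<sigma> :: "real \<Rightarrow> (nat \<times> nat) option"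
  assumes tasks: "rm_task_set n \<tau>"
    and legal: "legal_releases n \<tau> N r"
    and sched: "rm_schedule n \<tau> N r \<sigma>"
begin

lemma valid: "i \<in> {1..n} \<Longrightarrow> valid_mf_task (\<tau> i)"
  using tasks by (simp add: rm_task_set_def)

lemma period_pos: "i \<in> {1..n} \<Longrightarrow> 0 < period (\<tau> i)"
  using valid by (simp add: valid_mf_task_def)

section \<open>Release times\<close>

lemma release_nonneg: "is_job n N (i, j) \<Longrightarrow> 0 \<le> r i j"
  using legal by (simp add: legal_releases_def)

lemma release_gap:
  "is_job n N (i, j + d) \<Longrightarrow> r i j + real d * period (\<tau> i) \<le> r i (j + d)"
proof (induction d)
  case (Suc d)
  have "is_job n N (i, j + d)"
    using Suc.prems unfolding is_job_def
    by (auto intro: order.strict_trans[of "enat (j + d)" "enat (Suc (j + d))"])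
  moreover have "r i (j + d) + period (\<tau> i) \<le> r i (Suc (j + d))"
    using Suc.prems legal by (simp add: legal_releases_def)
  ultimately show ?case using Suc.IH by (simp add: algebra_simps)
qed simp

lemma is_job_earlier: "is_job n N (i, j) \<Longrightarrow> j' \<le> j \<Longrightarrow> is_job n N (i, j')"
  unfolding is_job_def by (auto intro: order.strict_trans1[of "enat j'" "enat j"])

section \<open>Service as a function of time\<close>

lemma service_lmeasurable: "{s. 0 \<le> s \<and> s < t \<and> \<sigma> s = Some J} \<in> lmeasurable"
proof -
  have "{s. 0 \<le> s \<and> \<sigma> s = Some J} \<in> sets lebesgue"
    using sched unfolding rm_schedule_def by blast
  moreover have "{0..<t} \<in> sets lebesgue" by simp
  ultimately have "{0..<t} \<inter> {s. 0 \<le> s \<and> \<sigma> s = Some J} \<in> sets lebesgue" by blast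
  moreover have "{0..<t} \<inter> {s. 0 \<le> s \<and> \<sigma> s = Some J} = {s. 0 \<le> s \<and> s < t \<and> \<sigma> s = Some J}"
    by auto
  moreover have "bounded ({0..<t} \<inter> {s. 0 \<le> s \<and> \<sigma> s = Some J})"
    by (rule bounded_subset[of "{0..t}"]) auto
  ultimately show ?thesis using bounded_set_imp_lmeasurable by metis
qed

lemma service_mono: "s \<le> t \<Longrightarrow> service \<sigma> J s \<le> service \<sigma> J t"
  unfolding service_def by (intro measure_mono_fmeasurable service_lmeasurable fmeasurableD) auto

text \<open>The times before \<open>t\<close> at which the job runs are covered by those before
  \<open>s\<close> together with \<open>{s..t}\<close>.\<close>

lemma service_le_add:
  assumes "s \<le> t"
  shows "service \<sigma> J t \<le> service \<sigma> J s + (t - s)"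
proof -
  have "service \<sigma> J t \<le> measure lebesgue ({q. 0 \<le> q \<and> q < s \<and> \<sigma> q = Some J} \<union> {s..t})"
    unfolding service_def
    by (intro measure_mono_fmeasurable fmeasurable.Un service_lmeasurable fmeasurableD) auto
  also have "\<dots> \<le> service \<sigma> J s + measure lebesgue {s..t}"
    unfolding service_def by (intro measure_Un_le service_lmeasurable fmeasurableD) auto
  finally show ?thesis using assms by simp
qed

text \<open>Service is monotone and grows at rate at most one, hence 1-Lipschitz. Continuity
  provides the moment at which a job has received exactly its execution time.\<close>

lemma continuous_on_service: "continuous_on A (service \<sigma> J)"
proof (rule continuous_on_subset)
  have "1-lipschitz_on UNIV (service \<sigma> J)"
  proof (rule lipschitz_onI)
    fix x y :: real
    show "dist (service \<sigma> J x) (service \<sigma> J y) \<le> 1 * dist x y"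
      using service_mono[of x y J] service_mono[of y x J]
        service_le_add[of x y J] service_le_add[of y x J]
      by (cases "x \<le> y") (auto simp: dist_real_def)
  qed simp
  then show "continuous_on UNIV (service \<sigma> J)" by (rule lipschitz_on_continuous_on)
qed simp

lemma finished_mono: "finished_by \<tau> \<sigma> J s \<Longrightarrow> s \<le> t \<Longrightarrow> finished_by \<tau> \<sigma> J t"
  unfolding finished_by_def using service_mono by (meson order_trans)

lemma running_imp_ready: "0 \<le> s \<Longrightarrow> \<sigma> s = Some J \<Longrightarrow> ready n \<tau> N r \<sigma> J s"
  using sched unfolding rm_schedule_def by blast

text \<open>By continuity, a job that received more than its execution time would have been
  served exactly that much at an earlier time, and from then on it is finished and never runs.\<close>
lemma service_le_exec_time:
  assumes "is_job n N J"
  shows "service \<sigma> J t \<le> exec_time (\<tau> (fst J)) (snd J)"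
proof (rule ccontr)
  let ?c = "exec_time (\<tau> (fst J)) (snd J)"
  assume less: "\<not> service \<sigma> J t \<le> ?c"
  have c: "0 < ?c"
    using assms exec_time_pos valid by (simp add: is_job_def)
  have zero: "service \<sigma> J x = 0" if "x \<le> 0" for x
  proof -
    have "{s. 0 \<le> s \<and> s < x \<and> \<sigma> s = Some J} = {}" using that by auto
    then show ?thesis unfolding service_def by (simp only: measure_empty)
  qed
  have "0 \<le> t" using zero[of t] less c by fastforce
  moreover have "continuous_on {0..t} (service \<sigma> J)" by (rule continuous_on_service)
  ultimately obtain x where x: "0 \<le> x" "x \<le> t" "service \<sigma> J x = ?c"
    using IVT'[of "service \<sigma> J" 0 ?c t] zero[of 0] less c by auto
  have "s < x" if "0 \<le> s" "\<sigma> s = Some J" for s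
  proof (rule ccontr)
    assume "\<not> s < x"
    then have "finished_by \<tau> \<sigma> J s"
      using finished_mono[of J x s] x by (simp add: finished_by_def)
    then show False using running_imp_ready[OF that] by (simp add: ready_def)
  qed
  then have "{s. 0 \<le> s \<and> s < t \<and> \<sigma> s = Some J} = {s. 0 \<le> s \<and> s < x \<and> \<sigma> s = Some J}"
    using x by force
  then have "service \<sigma> J t = service \<sigma> J x" by (simp add: service_def)
  with x less show False by simp
qed

text \<open>Priority is the lexicographic order on pairs: well-foundedness yields a minimal ready
  job, and linearity makes it precede every other ready job, so it is the one executing.\<close>

lemma busy_if_ready:
  assumes "0 \<le> s" "ready n \<tau> N r \<sigma> J s"
  obtains J' where "\<sigma> s = Some J'" "J' = J \<or> higher_priority J' J"
proof -
  have hp: "higher_priority A B \<longleftrightarrow> (A, B) \<in> less_than <*lex*> less_than" for A B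
    by (cases A; cases B) (auto simp: higher_priority_def)
  have "wf (less_than <*lex*> less_than)" by (intro wf_lex_prod wf_less_than)
  then obtain J' where J': "ready n \<tau> N r \<sigma> J' s"
    "\<And>A. (A, J') \<in> less_than <*lex*> less_than \<Longrightarrow> \<not> ready n \<tau> N r \<sigma> A s"
    using assms(2) wfE_min[of _ J "{J. ready n \<tau> N r \<sigma> J s}"] by (metis mem_Collect_eq)
  have first: "A = J' \<or> higher_priority J' A" if "ready n \<tau> N r \<sigma> A s" for A
  proof -
    have "\<not> higher_priority A J'" using J'(2)[of A] that by (auto simp: hp)
    then show ?thesis
      unfolding higher_priority_def by (metis linorder_neqE_nat prod_eq_iff)
  qed
  then have "\<sigma> s = Some J'"
    using sched assms(1) J'(1) unfolding rm_schedule_def by blast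
  then show ?thesis using that first[OF assms(2)] by blast
qed

text \<open>Counted from the first job \<open>j0\<close> of the window, the job with index
  \<open>j0 + d\<close> is released at least \<open>d\<close> periods later, so the indices in
  \<open>F\<close> lie in a run of consecutive ones starting at \<open>j0\<close>.\<close>

lemma workload_le_phi:
  fixes a x :: real
  assumes i: "i \<in> {1..n}"
  defines "F \<equiv> {j. is_job n N (i, j) \<and> a \<le> r i j \<and> r i j < a + x}"
  shows "finite F" "(\<Sum>j\<in>F. exec_time (\<tau> i) j) \<le> phi (\<tau> i) (nat \<lceil>x / period (\<tau> i)\<rceil>)"
proof -
  define m where "m = nat \<lceil>x / period (\<tau> i)\<rceil>"
  have "finite F \<and> (\<Sum>j\<in>F. exec_time (\<tau> i) j) \<le> phi (\<tau> i) m"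
  proof (cases "F = {}")
    case True
    then show ?thesis using phi_mono[OF valid[OF i], of 0 m] valid[OF i] by simp
  next
    case False
    define j0 where "j0 = (LEAST j. j \<in> F)"
    have j0: "j0 \<in> F" "\<And>j. j \<in> F \<Longrightarrow> j0 \<le> j"
      using False unfolding j0_def by (auto intro: LeastI Least_le)
    have sub: "F \<subseteq> (\<lambda>q. j0 + q) ` {..<m}"
    proof
      fix j assume j: "j \<in> F"
      define d where "d = j - j0"
      have jd: "j = j0 + d" using j0(2)[OF j] by (simp add: d_def)
      have "r i j0 + real d * period (\<tau> i) \<le> r i j"
        using release_gap[of i j0 d] j unfolding jd F_def by blast
      then have "real d * period (\<tau> i) < x" using j j0(1) by (auto simp: F_def)
      \<comment> \<open>Strictness, due to the half-open window, keeps \<open>d\<close> below the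
        ceiling, so at most \<open>m\<close> jobs are counted and not \<open>m + 1\<close>.\<close>
      then have "real d < x / period (\<tau> i)" using period_pos[OF i] by (simp add: field_simps)
      then have "d < m" unfolding m_def by linarith
      then show "j \<in> (\<lambda>q. j0 + q) ` {..<m}" using jd by auto
    qed
    then have "(\<Sum>j\<in>F. exec_time (\<tau> i) j) \<le> (\<Sum>j\<in>(\<lambda>q. j0 + q) ` {..<m}. exec_time (\<tau> i) j)"
      using exec_time_pos[OF valid[OF i]] by (intro sum_mono2) (auto simp: less_imp_le)
    also have "\<dots> = (\<Sum>q<m. exec_time (\<tau> i) (j0 + q))"
      by (subst sum.reindex) (auto simp: inj_on_def)
    also have "\<dots> \<le> phi (\<tau> i) m" by (rule sum_exec_time_le_phi[OF valid[OF i]])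
    finally show ?thesis using finite_subset[OF sub] by simp
  qed
  then show "finite F" "(\<Sum>j\<in>F. exec_time (\<tau> i) j) \<le> phi (\<tau> i) (nat \<lceil>x / period (\<tau> i)\<rceil>)"
    by (auto simp: m_def)
qed

text \<open>The execution sets of the jobs in \<open>A\<close> cover the open interval, and the
  measure is subadditive. Counting service from time 0 instead of \<open>a\<close> only enlarges the
  right-hand side.\<close>

lemma interval_length_le_service:
  assumes "finite A" "0 \<le> a"
    and busy: "\<And>s. a < s \<Longrightarrow> s < b \<Longrightarrow> \<exists>J \<in> A. \<sigma> s = Some J"
  shows "b - a \<le> (\<Sum>J\<in>A. service \<sigma> J b)"
proof (cases "a \<le> b")
  case True
  have "{a<..<b} \<subseteq> (\<Union>J\<in>A. {s. 0 \<le> s \<and> s < b \<and> \<sigma> s = Some J})"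
    using busy \<open>0 \<le> a\<close> by fastforce
  then have "measure lebesgue {a<..<b} \<le> measure lebesgue (\<Union>J\<in>A. {s. 0 \<le> s \<and> s < b \<and> \<sigma> s = Some J})"
    using \<open>finite A\<close> service_lmeasurable
    by (intro measure_mono_fmeasurable fmeasurable.finite_UN) auto
  also have "\<dots> \<le> (\<Sum>J\<in>A. service \<sigma> J b)"
    unfolding service_def using \<open>finite A\<close> service_lmeasurable
    by (intro measure_UNION_le) (auto dest: fmeasurableD)
  finally show ?thesis using True by simp
next
  case False
  then have "b - a \<le> 0" by simp
  also have "0 \<le> (\<Sum>J\<in>A. service \<sigma> J b)" by (intro sum_nonneg) (simp add: service_def)
  finally show ?thesis .
qed

text \<open>The start of the busy period in which the release time falls is the last time
  at which no earlier-released job of higher priority is pending.\<close>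
lemma busy_period_start:
  assumes "0 \<le> R" "k \<le> n"
  obtains a where "0 \<le> a" "a \<le> R"
    "\<And>i j. i < k \<Longrightarrow> is_job n N (i, j) \<Longrightarrow> r i j < a \<Longrightarrow> finished_by \<tau> \<sigma> (i, j) a"
    "\<And>s. a < s \<Longrightarrow> s \<le> R \<Longrightarrow> \<exists>i j. i < k \<and> ready n \<tau> N r \<sigma> (i, j) s"
proof -
  define Q where "Q = {x \<in> {0..R}. \<forall>i j. i < k \<longrightarrow> is_job n N (i, j) \<longrightarrow> r i j < x \<longrightarrow>
    finished_by \<tau> \<sigma> (i, j) x}"
  have Q0: "0 \<in> Q" using assms release_nonneg by (force simp: Q_def)
  have bdd: "bdd_above Q" unfolding Q_def by (rule bdd_above_mono[of "{0..R}"]) auto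
  define a where "a = Sup Q"
  have a: "0 \<le> a" "a \<le> R"
    using cSup_upper[OF Q0 bdd] Q0 unfolding a_def by (auto intro!: cSup_least simp: Q_def)
  show ?thesis
  proof (rule that[OF a])
    \<comment> \<open>The supremum \<open>a\<close> is not yet known to lie in \<open>Q\<close>, so
      a point of \<open>Q\<close> between the release and \<open>a\<close> is used, and completion
      persists up to \<open>a\<close>.\<close>
    fix i j assume ij: "i < k" "is_job n N (i, j)" "r i j < a"
    then obtain x where x: "x \<in> Q" "r i j < x"
      using less_cSup_iff[of Q "r i j"] Q0 bdd unfolding a_def by auto
    then have "x \<le> a" unfolding a_def using bdd by (intro cSup_upper)
    with x ij show "finished_by \<tau> \<sigma> (i, j) a"
      unfolding Q_def using finished_mono by blast
  next
    fix s assume s: "a < s" "s \<le> R"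
    then have "s \<notin> Q" using cSup_upper[OF _ bdd, of s] unfolding a_def by auto
    then show "\<exists>i j. i < k \<and> ready n \<tau> N r \<sigma> (i, j) s"
      using s a unfolding Q_def ready_def by (auto intro: less_imp_le)
  qed
qed

text \<open>After a missed deadline, only job \<open>(k, j)\<close> and higher-priority jobs
  released since the busy period began can run during \<open>(a, a + x)\<close>. Their total service
  falls short of the demand, hence of \<open>x\<close>, although the processor never idles
  there.\<close>

lemma finished_by_deadline_if_demand_fits:
  assumes k: "k \<in> {1..n}" and x: "0 < x" "x \<le> period (\<tau> k)"
    and demand: "phi (\<tau> k) 1 + (\<Sum>i = 1..k - 1. phi (\<tau> i) (nat \<lceil>x / period (\<tau> i)\<rceil>)) \<le> x"
  shows "is_job n N (k, j) \<Longrightarrow> finished_by \<tau> \<sigma> (k, j) (r k j + period (\<tau> k))"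
proof (induction j rule: less_induct)
  case (less j)
  have earlier: "finished_by \<tau> \<sigma> (k, j') (r k j)" if "j' < j" for j'
  proof -
    have "is_job n N (k, j')" using is_job_earlier less.prems that by simp
    then have "finished_by \<tau> \<sigma> (k, j') (r k j' + period (\<tau> k))" using less.IH that by blast
    \<comment> \<open>Deadlines are implicit, so an earlier job of the same task is due no later
      than the release of job \<open>j\<close>.\<close>
    moreover have "r k j' + period (\<tau> k) \<le> r k j"
    proof -
      have "1 * period (\<tau> k) \<le> real (j - j') * period (\<tau> k)"
        using that period_pos[OF k] by (intro mult_right_mono) auto
      then show ?thesis using release_gap[of k j' "j - j'"] less.prems that by simp
    qed
    ultimately show ?thesis by (rule finished_mono)
  qed
  obtain a where a: "0 \<le> a" "a \<le> r k j"
    and clean: "\<And>i j'. i < k \<Longrightarrow> is_job n N (i, j') \<Longrightarrow> r i j' < a \<Longrightarrow> finished_by \<tau> \<sigma> (i, j') a"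
    and pending: "\<And>s. a < s \<Longrightarrow> s \<le> r k j \<Longrightarrow> \<exists>i j'. i < k \<and> ready n \<tau> N r \<sigma> (i, j') s"
    using busy_period_start[of "r k j" k] release_nonneg[OF less.prems] k by auto
  show ?case
  proof (rule ccontr)
    assume missed: "\<not> ?thesis"
    \<comment> \<open>Since \<open>a \<le> r k j\<close> and \<open>x\<close> is at most the period,
      \<open>a + x\<close> does not lie beyond the deadline.\<close>
    have unfinished: "\<not> finished_by \<tau> \<sigma> (k, j) s" if "s \<le> a + x" for s
      using missed finished_mono[of "(k, j)" s "r k j + period (\<tau> k)"] that a x by auto
    define F where "F i = {j'. is_job n N (i, j') \<and> a \<le> r i j' \<and> r i j' < a + x}" for i
    have fin: "finite (Sigma {1..k - 1} F)"
      using workload_le_phi(1) k unfolding F_def by (intro finite_SigmaI) auto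
    have busy: "\<exists>J \<in> insert (k, j) (Sigma {1..k - 1} F). \<sigma> s = Some J"
      if s: "a < s" "s < a + x" for s
    proof -
      have s0: "0 \<le> s" using a s by simp
      \<comment> \<open>Up to the release of \<open>(k, j)\<close> some higher-priority job is
        pending; afterwards \<open>(k, j)\<close> itself is still unfinished.\<close>
      obtain i j' where run: "\<sigma> s = Some (i, j')" and ij: "i < k \<or> i = k \<and> j' \<le> j"
      proof (cases "s \<le> r k j")
        case True
        then obtain i j' where "i < k" "ready n \<tau> N r \<sigma> (i, j') s" using pending s by blast
        with s0 show ?thesis
          by (elim busy_if_ready[where J = "(i, j')"])
            (auto simp: higher_priority_def intro: that)
      next
        case False
        then have "ready n \<tau> N r \<sigma> (k, j) s"
          using less.prems unfinished[of s] s by (simp add: ready_def)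
        with s0 show ?thesis
          by (elim busy_if_ready[where J = "(k, j)"])
            (auto simp: higher_priority_def intro: that)
      qed
      have rdy: "is_job n N (i, j')" "r i j' \<le> s" "\<not> finished_by \<tau> \<sigma> (i, j') s"
        using running_imp_ready[OF s0 run] by (auto simp: ready_def)
      show ?thesis
      proof (cases "i < k")
        case True
        then have "a \<le> r i j'"
          using clean[OF True rdy(1)] finished_mono[of "(i, j')" a s] rdy(3) s by force
        then have "(i, j') \<in> Sigma {1..k - 1} F"
          using True rdy(1,2) s by (auto simp: F_def is_job_def)
        with run show ?thesis by blast
      next
        case False
        then have "i = k" "j' \<le> j" using ij by auto
        moreover have "j' = j"
        proof (rule ccontr)
          assume "j' \<noteq> j"
          then have "j' < j" using \<open>j' \<le> j\<close> by simp
          \<comment> \<open>An earlier job of task \<open>k\<close> is finished once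
            \<open>(k, j)\<close> is released; before that, a pending higher-priority job keeps it
            from running.\<close>
          show False
          proof (cases "r k j \<le> s")
            case True
            then show False
              using finished_mono[OF earlier[OF \<open>j' < j\<close>], of s] rdy(3) \<open>i = k\<close> by simp
          next
            case False
            then obtain i'' j'' where "i'' < k" "ready n \<tau> N r \<sigma> (i'', j'') s"
              using pending[of s] s by force
            with s0 show False
              by (elim busy_if_ready[where J = "(i'', j'')"])
                (use run \<open>i = k\<close> in \<open>auto simp: higher_priority_def\<close>)
          qed
        qed
        ultimately show ?thesis using run by simp
      qed
    qed
    have "x \<le> (\<Sum>J\<in>insert (k, j) (Sigma {1..k - 1} F). service \<sigma> J (a + x))"
      using interval_length_le_service[of "insert (k, j) (Sigma {1..k - 1} F)" a "a + x"] fin a busy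
      by simp
    also have "\<dots> = service \<sigma> (k, j) (a + x) + (\<Sum>J\<in>Sigma {1..k - 1} F. service \<sigma> J (a + x))"
      using fin k by (subst sum.insert) auto
    \<comment> \<open>This is the strict inequality that makes the chain contradict
      \<open>demand\<close>.\<close>
    also have "service \<sigma> (k, j) (a + x) < exec_time (\<tau> k) j"
      using unfinished[of "a + x"] by (simp add: finished_by_def)
    also have "exec_time (\<tau> k) j \<le> phi (\<tau> k) 1"
      by (rule exec_time_le_phi_1[OF valid[OF k]])
    also have "(\<Sum>J\<in>Sigma {1..k - 1} F. service \<sigma> J (a + x))
        \<le> (\<Sum>J\<in>Sigma {1..k - 1} F. exec_time (\<tau> (fst J)) (snd J))"
      by (intro sum_mono service_le_exec_time) (auto simp: F_def)
    also have "\<dots> = (\<Sum>i = 1..k - 1. \<Sum>j'\<in>F i. exec_time (\<tau> i) j')"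
      using workload_le_phi(1) k unfolding F_def by (subst sum.Sigma) (auto simp: case_prod_beta)
    also have "\<dots> \<le> (\<Sum>i = 1..k - 1. phi (\<tau> i) (nat \<lceil>x / period (\<tau> i)\<rceil>))"
      unfolding F_def using k by (intro sum_mono workload_le_phi(2)) auto
    finally show False using demand by simp
  qed
qed

end

section \<open>Schedulability conditions\<close>

lemma ell_pos:
  assumes "0 < period (\<tau> i)" "period (\<tau> i) \<le> period (\<tau> k)"
  shows "1 \<le> ell \<tau> k i"
proof -
  have "1 \<le> period (\<tau> k) / period (\<tau> i)" using assms by simp
  then show ?thesis unfolding ell_def by linarith
qed

lemma f_task_pos:
  assumes "valid_mf_task (\<tau> i)" "period (\<tau> i) \<le> period (\<tau> k)"
  shows "0 < f_task \<tau> k i"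
  unfolding f_task_def
  using assms ell_pos[of \<tau> i k] phi_1_pos[of "\<tau> i"] delta_min_pos[of "\<tau> i" "ell \<tau> k i + 1"]
  by (intro divide_pos_pos mult_pos_pos) (auto simp: valid_mf_task_def)

text \<open>As \<open>ell \<tau> k i\<close> is at least 1, the index 2 takes part in the minimum in
  the denominator, and the factor \<open>ell \<tau> k i\<close> does not decrease the
  numerator.\<close>

lemma f_task_ge:
  assumes "valid_mf_task (\<tau> i)" "period (\<tau> i) \<le> period (\<tau> k)"
  shows "phi (\<tau> i) 1 / (phi (\<tau> i) 2 - phi (\<tau> i) 1) \<le> f_task \<tau> k i"
proof -
  have l: "1 \<le> ell \<tau> k i"
    using assms by (intro ell_pos) (auto simp: valid_mf_task_def)
  then have "delta_min (\<tau> i) (ell \<tau> k i + 1) \<le> delta (\<tau> i) 2"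
    by (intro delta_min_le) auto
  also have "\<dots> = phi (\<tau> i) 2 - phi (\<tau> i) 1" by (simp add: delta_def)
  finally show ?thesis
    unfolding f_task_def using l phi_1_pos[OF assms(1)] delta_min_pos[OF assms(1)]
    by (intro frac_le) (auto simp: mult_le_cancel_left1)
qed

lemma phi_demand_le:
  fixes \<tau> k i and f x :: real
  defines "w \<equiv> real (ell \<tau> k i) * period (\<tau> i) * utilization (\<tau> i)"
  assumes v: "valid_mf_task (\<tau> i)" and T: "period (\<tau> i) \<le> period (\<tau> k)"
    and f: "0 < f" "f \<le> f_task \<tau> k i" and x: "x \<le> period (\<tau> k)"
  shows "phi (\<tau> i) (nat \<lceil>x / period (\<tau> i)\<rceil>)
    \<le> w + (if real (ell \<tau> k i) * period (\<tau> i) < x then 1 / f * w else 0)"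
proof -
  define l where "l = ell \<tau> k i"
  have p: "0 < period (\<tau> i)" using v by (simp add: valid_mf_task_def)
  have w: "real l * phi (\<tau> i) 1 \<le> w"
    using mult_left_mono[OF phi_1_le_utilization[OF v], of "real l"]
    by (simp add: w_def l_def algebra_simps)
  show ?thesis
  proof (cases "real l * period (\<tau> i) < x")
    case True
    have "x / period (\<tau> i) \<le> period (\<tau> k) / period (\<tau> i)"
      using x p by (simp add: divide_right_mono)
    also have "\<dots> < real l + 1" unfolding l_def ell_def by linarith
    finally have "nat \<lceil>x / period (\<tau> i)\<rceil> \<le> l + 1" by linarith
    then have "phi (\<tau> i) (nat \<lceil>x / period (\<tau> i)\<rceil>) \<le> phi (\<tau> i) (l + 1)"
      by (rule phi_mono[OF v])
    also have "\<dots> \<le> real l * phi (\<tau> i) 1 + delta_min (\<tau> i) (l + 1)"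
      by (rule phi_Suc_le_delta_min[OF v])
    \<comment> \<open>This is \<open>f \<le> f_task \<tau> k i\<close> solved for the denominator of
      \<open>f_task\<close>.\<close>
    also have "delta_min (\<tau> i) (l + 1) \<le> 1 / f * (real l * phi (\<tau> i) 1)"
      using f delta_min_pos[OF v, of "l + 1"]
      by (simp add: f_task_def l_def[symmetric] field_simps)
    also have "\<dots> \<le> 1 / f * w" using w f by (intro mult_left_mono) auto
    finally show ?thesis using w True by (simp add: l_def)
  next
    case False
    then have "x / period (\<tau> i) \<le> real l" using p by (simp add: field_simps)
    then have "nat \<lceil>x / period (\<tau> i)\<rceil> \<le> l" by linarith
    then have "phi (\<tau> i) (nat \<lceil>x / period (\<tau> i)\<rceil>) \<le> phi (\<tau> i) l"
      by (rule phi_mono[OF v])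
    also have "\<dots> \<le> w" using phi_le_linear[OF v, of l] w by simp
    finally show ?thesis using False by (simp add: l_def)
  qed
qed

text \<open>By AM-GM, the \<open>k\<close>-th root of the product is at most the mean of its
  factors, which is the sum of the \<open>u j\<close> divided by \<open>f * real k\<close>, plus 1.
  Strict monotonicity of \<open>powr\<close> then removes the root.\<close>

lemma prod_le_if_sum_le:
  fixes u :: "nat \<Rightarrow> real"
  assumes k: "1 \<le> k" and f: "0 < f" and u: "\<And>j. j \<in> {1..k} \<Longrightarrow> 0 \<le> u j"
    and sum_le: "(\<Sum>j = 1..k. u j) \<le> f * real k * (((f + 1) / f) powr (1 / real k) - 1)"
  shows "(\<Prod>j = 1..k. (u j / f + 1)) \<le> (f + 1) / f"
proof -
  let ?P = "\<Prod>j = 1..k. (u j / f + 1)"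
  have "?P powr (1 / real k) \<le> (\<Sum>j = 1..k. (u j / f + 1) / real k)"
    using arith_geom_mean[of "{1..k}" "\<lambda>j. u j / f + 1"] k f u by simp
  also have "\<dots> = (\<Sum>j = 1..k. u j) / (f * real k) + 1"
    using k by (simp add: sum_divide_distrib[symmetric] sum.distrib add_divide_distrib)
  also have "\<dots> \<le> ((f + 1) / f) powr (1 / real k)"
    using sum_le k f by (simp add: field_simps)
  finally have "?P powr (1 / real k) \<le> ((f + 1) / f) powr (1 / real k)" .
  then show ?thesis
    using k f powr_less_mono2[of "1 / real k" "(f + 1) / f" ?P] by fastforce
qed

text \<open>A feasible point for \<open>b = 1 / f\<close>, \<open>c\<close> the utilization of task
  \<open>k\<close> and \<open>T\<close> its period is a time at which the demand fits, because
  \<open>phi_demand_le\<close> bounds the demand by exactly these terms.\<close>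

lemma rm_schedulable_if_prod_le:
  assumes tasks: "rm_task_set n \<tau>" and k: "k \<in> {1..n}"
    and f: "0 < f" "\<And>i. i \<in> {1..k - 1} \<Longrightarrow> f \<le> f_task \<tau> k i"
    and prod_le: "(utilization (\<tau> k) / f + 1) * (\<Prod>j = 1..k - 1. (utilization (\<tau> j) / f + 1))
      \<le> (f + 1) / f"
  shows "rm_schedulable n \<tau> k"
proof -
  let ?A = "{1..k - 1}"
  let ?u = "\<lambda>i. utilization (\<tau> i)"
  let ?t = "\<lambda>i. real (ell \<tau> k i) * period (\<tau> i)"
  have v: "valid_mf_task (\<tau> i)" "0 < period (\<tau> i)" if "i \<in> {1..n}" for i
    using tasks that by (auto simp: rm_task_set_def valid_mf_task_def)
  have A: "i \<in> {1..n}" "period (\<tau> i) \<le> period (\<tau> k)" if "i \<in> ?A" for i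
    using that k tasks by (auto simp: rm_task_set_def)
  have "\<exists>x. 0 < x \<and> x \<le> period (\<tau> k) \<and>
    ?u k * period (\<tau> k) + (\<Sum>i\<in>?A. ?t i * ?u i) + 1 / f * (\<Sum>i \<in> {i \<in> ?A. ?t i < x}. ?t i * ?u i) \<le> x"
  proof (rule exists_feasible_point)
    fix i assume i: "i \<in> ?A"
    show "0 \<le> ?u i" using utilization_pos[OF v(1)[OF A(1)[OF i]]] by simp
    show "0 < ?t i" using ell_pos[of \<tau> i k] v(2)[OF A(1)[OF i]] A(2)[OF i] by simp
    have "real (ell \<tau> k i) \<le> period (\<tau> k) / period (\<tau> i)"
      unfolding ell_def using v(2)[OF k] v(2)[OF A(1)[OF i]] by simp
    then show "?t i \<le> period (\<tau> k)" using v(2)[OF A(1)[OF i]] by (simp add: field_simps)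
  next
    have "1 + 1 / f = (f + 1) / f" using f(1) by (simp add: field_simps)
    with prod_le
    show "(1 / f * ?u k + 1) * (\<Prod>i\<in>?A. 1 / f * ?u i + 1) \<le> 1 + 1 / f" by simp
  qed (use f(1) v[OF k] utilization_pos in auto)
  then obtain x where x: "0 < x" "x \<le> period (\<tau> k)"
    and fits: "?u k * period (\<tau> k) + (\<Sum>i\<in>?A. ?t i * ?u i)
      + 1 / f * (\<Sum>i \<in> {i \<in> ?A. ?t i < x}. ?t i * ?u i) \<le> x" by blast
  have "(\<Sum>i\<in>?A. phi (\<tau> i) (nat \<lceil>x / period (\<tau> i)\<rceil>))
      \<le> (\<Sum>i\<in>?A. ?t i * ?u i + (if ?t i < x then 1 / f * (?t i * ?u i) else 0))"
    by (intro sum_mono phi_demand_le v(1) A f x(2))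
  also have "\<dots> = (\<Sum>i\<in>?A. ?t i * ?u i) + 1 / f * (\<Sum>i \<in> {i \<in> ?A. ?t i < x}. ?t i * ?u i)"
    by (simp only: sum.distrib sum_distrib_left sum.inter_filter[OF finite_atLeastAtMost])
      (auto intro!: sum.cong)
  finally have demand: "phi (\<tau> k) 1 + (\<Sum>i\<in>?A. phi (\<tau> i) (nat \<lceil>x / period (\<tau> i)\<rceil>)) \<le> x"
    using fits phi_1_le_utilization[OF v(1)[OF k]] by linarith
  show ?thesis
    unfolding rm_schedulable_def
  proof (intro allI impI)
    fix N r \<sigma> j
    assume "legal_releases n \<tau> N r" "rm_schedule n \<tau> N r \<sigma>" and job: "is_job n N (k, j)"
    then interpret rm_run n \<tau> N r \<sigma> using tasks by unfold_locales
    show "finished_by \<tau> \<sigma> (k, j) (r k j + period (\<tau> k))"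
      by (rule finished_by_deadline_if_demand_fits[OF k x demand job])
  qed
qed

theorem theorem7:
  fixes n k :: nat and \<tau> :: "nat \<Rightarrow> mf_task" and f :: real
  assumes tasks: "rm_task_set n \<tau>"
    and k: "2 \<le> k" "k \<le> n"
    and hp: "\<forall>i \<in> {1..k - 1}. rm_schedulable n \<tau> i"
    and f: "f = f_min \<tau> k"
  shows "((utilization (\<tau> k) / f + 1) * (\<Prod>j = 1..k - 1. (utilization (\<tau> j) / f + 1)) \<le> (f + 1) / f
          \<or> (\<Sum>j = 1..k. utilization (\<tau> j)) \<le> f * real k * (((f + 1) / f) powr (1 / real k) - 1)
          \<longrightarrow> rm_schedulable n \<tau> k)
       \<and> (\<forall>i \<in> {1..k - 1}. f_task \<tau> k i \<ge> phi (\<tau> i) 1 / (phi (\<tau> i) 2 - phi (\<tau> i) 1))"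
proof -
  have v: "valid_mf_task (\<tau> i)" if "i \<in> {1..n}" for i
    using tasks that by (simp add: rm_task_set_def)
  have A: "valid_mf_task (\<tau> i)" "period (\<tau> i) \<le> period (\<tau> k)" if "i \<in> {1..k - 1}" for i
    using that k tasks by (auto simp: rm_task_set_def)
  \<comment> \<open>From \<open>2 \<le> k\<close> the index set is nonempty, so the minimum is
    attained and inherits positivity.\<close>
  have "f \<in> f_task \<tau> k ` {1..k - 1}"
    unfolding f f_min_def using k by (intro Min_in) auto
  then have f_pos: "0 < f" using f_task_pos A by auto
  have f_le: "f \<le> f_task \<tau> k i" if "i \<in> {1..k - 1}" for i
    unfolding f f_min_def using that by (intro Min_le) auto
  have split: "(\<Prod>j = 1..k. (utilization (\<tau> j) / f + 1))
      = (utilization (\<tau> k) / f + 1) * (\<Prod>j = 1..k - 1. (utilization (\<tau> j) / f + 1))"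
    using k by (cases k) (auto simp: mult.commute)
  have "rm_schedulable n \<tau> k"
    if "(utilization (\<tau> k) / f + 1) * (\<Prod>j = 1..k - 1. (utilization (\<tau> j) / f + 1)) \<le> (f + 1) / f"
    using k by (intro rm_schedulable_if_prod_le[OF tasks _ f_pos f_le that]) auto
  moreover have "(\<Prod>j = 1..k. (utilization (\<tau> j) / f + 1)) \<le> (f + 1) / f"
    if "(\<Sum>j = 1..k. utilization (\<tau> j)) \<le> f * real k * (((f + 1) / f) powr (1 / real k) - 1)"
    using k by (intro prod_le_if_sum_le[OF _ f_pos _ that] less_imp_le[OF utilization_pos] v) auto
  ultimately show ?thesis
    using f_task_ge A unfolding split by blast
qed

end
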